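(* Let $H$ and $G$ be graphs and let $k\geq 1$ be an integer. If $H$ is $k$-$G$-free-minimal, then \[|V(H)|\geq (k-1)(|V(G)|-1)+1.\]
   Context: All graphs are finite, simple and undirected. For a graph $G$ on at least 2 vertices, a $G$-free $k$-colouring of a graph $H$ is a map $\pi:V(H)\to\{1,\dots,k\}$ such that for every $i$ the subgraph of $H$ induced by $\pi^{-1}(i)$ contains no subgraph isomorphic to $G$. The $G$-free chromatic number $\chi_G(H)$ is the least $k$ for which a $G$-free $k$-colouring of $H$ exists. $H$ is $G$-free-minimal if $\chi_G(H\setminus\{e\})=\chi_G(H)-1$ for every edge $e\in E(H)$; $H$ is $k$-$G$-free-minimal if moreover $\chi_G(H)=k$. *)

theory Defs
  imports "Graph_Theory.Graph_Theory"
begin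

text \<open>Finite simple undirected graphs are instances of \<^locale>\<open>pair_graph\<close>: an undirected edge between
  \<open>u\<close> and \<open>v\<close> is the pair of arcs \<open>(u, v)\<close>, \<open>(v, u)\<close>.\<close>

text \<open>The subgraph need not be induced.\<close>

definition contains_copy :: "'a pair_pre_digraph \<Rightarrow> ('b, 'b \<times> 'b) pre_digraph \<Rightarrow> bool" where
  "contains_copy G H \<longleftrightarrow>
     (\<exists>K. pair_graph K \<and> subgraph (with_proj K) H \<and> digraph_iso (with_proj G) (with_proj K))"

definition free_colouring ::
  "'a pair_pre_digraph \<Rightarrow> nat \<Rightarrow> 'b pair_pre_digraph \<Rightarrow> ('b \<Rightarrow> nat) \<Rightarrow> bool" where
  "free_colouring G k H \<pi> \<longleftrightarrow>
     \<pi> ` pverts H \<subseteq> {1..k} \<and>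
     (\<forall>i \<in> {1..k}. \<not> contains_copy G (with_proj H \<restriction> {v \<in> pverts H. \<pi> v = i}))"

text \<open>The minimum exists if \<open>G\<close> has at least two vertices; see \<open>free_colouring_ex\<close> below.\<close>

definition free_chromatic_number :: "'a pair_pre_digraph \<Rightarrow> 'b pair_pre_digraph \<Rightarrow> nat" where
  "free_chromatic_number G H = (LEAST k. \<exists>\<pi>. free_colouring G k H \<pi>)"

text \<open>Deleting an undirected edge removes both of its arcs and no vertices.\<close>

definition del_edge :: "'b pair_pre_digraph \<Rightarrow> 'b \<times> 'b \<Rightarrow> 'b pair_pre_digraph" where
  "del_edge H e = H\<lparr>parcs := parcs H - {e, prod.swap e}\<rparr>"

definition free_minimal :: "'a pair_pre_digraph \<Rightarrow> 'b pair_pre_digraph \<Rightarrow> bool" where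
  "free_minimal G H \<longleftrightarrow>
     (\<forall>e \<in> parcs H. int (free_chromatic_number G (del_edge H e)) =
                    int (free_chromatic_number G H) - 1)"

definition k_free_minimal :: "nat \<Rightarrow> 'a pair_pre_digraph \<Rightarrow> 'b pair_pre_digraph \<Rightarrow> bool" where
  "k_free_minimal k G H \<longleftrightarrow> free_minimal G H \<and> free_chromatic_number G H = k"

lemma pair_graph_del_edge:
  assumes "pair_graph H"
  shows "pair_graph (del_edge H e)"
proof -
  interpret H: pair_graph H by fact
  show ?thesis
    using H.pair_finite_verts H.pair_finite_arcs H.arcs_symmetric
    by (cases e, unfold_locales)
      (auto simp: del_edge_def symmetric_def sym_def dest: H.wellformed' H.no_loops')
qed

lemma contains_copy_card:
  assumes "contains_copy G H" and "finite (verts H)"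
  shows "card (pverts G) \<le> card (verts H)"
proof -
  obtain K f where K: "verts (with_proj K) \<subseteq> verts H"
    and f: "inj_on (iso_verts f) (verts (with_proj G))"
    and Kf: "with_proj K = app_iso f (with_proj G)"
    using assms(1)
    unfolding contains_copy_def subgraph_def digraph_iso_def pre_digraph.digraph_isomorphism_def
    by blast
  have "iso_verts f ` pverts G \<subseteq> verts H"
    using K unfolding Kf by simp
  moreover have "inj_on (iso_verts f) (pverts G)"
    using f by simp
  ultimately show ?thesis
    using assms(2) card_inj_on_le by blast
qed

lemma free_colouring_ex:
  assumes "pair_graph H" and "2 \<le> card (pverts G)"
  shows "\<exists>k \<pi>. free_colouring G k H \<pi>"
proof -
  interpret H: pair_graph H by fact
  obtain \<pi> where \<pi>: "bij_betw \<pi> (pverts H) {1..card (pverts H)}"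
    using ex_bij_betw_finite_nat[OF H.pair_finite_verts] finite_same_card_bij
      H.pair_finite_verts by (metis card_atLeastAtMost diff_Suc_1 finite_atLeastAtMost)
  have "\<not> contains_copy G (with_proj H \<restriction> {v \<in> pverts H. \<pi> v = i})" for i
  proof
    let ?S = "{v \<in> pverts H. \<pi> v = i}"
    assume "contains_copy G (with_proj H \<restriction> ?S)"
    then have "card (pverts G) \<le> card ?S"
      using contains_copy_card[of G "with_proj H \<restriction> ?S"] H.pair_finite_verts by simp
    moreover have "card ?S \<le> 1"
      using \<pi> by (auto simp: card_le_Suc0_iff_eq H.pair_finite_verts bij_betw_def inj_on_def)
    ultimately show False using assms(2) by simp
  qed
  then have "free_colouring G (card (pverts H)) H \<pi>"
    using \<pi> by (auto simp: free_colouring_def bij_betw_def)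
  then show ?thesis by blast
qed

end

theory Submission
  imports Defs
begin

text \<open>A set of fewer than \<open>|V(G)|\<close> vertices cannot contain a copy of \<open>G\<close>. So if
  \<open>|V(H)| \<le> m (|V(G)| - 1)\<close>, cutting the vertices of \<open>H\<close> into \<open>m\<close> blocks of at most \<open>|V(G)| - 1\<close>
  vertices each gives a \<open>G\<close>-free colouring with \<open>m\<close> colours; take \<open>m = k - 1\<close>.\<close>

lemma ex_bounded_fibres:
  fixes S :: "'b set"
  assumes "finite S" and "d > 0" and "card S \<le> m * d"
  shows "\<exists>\<pi>. \<pi> ` S \<subseteq> {1..m} \<and> (\<forall>i. card {v \<in> S. \<pi> v = i} \<le> d)"
proof -
  obtain f where f: "bij_betw f S {0..<card S}"
    using ex_bij_betw_finite_nat[OF assms(1)] by blast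
  \<comment> \<open>\<open>f\<close> numbers \<open>S\<close> from 0, so the quotient by
    \<open>d\<close> picks out consecutive blocks of length \<open>d\<close>; adding 1 makes the
    colours start at 1.\<close>
  define \<pi> where "\<pi> v = f v div d + 1" for v
  have "f v div d < m" if "v \<in> S" for v
  proof -
    have "f v < m * d"
      using bij_betwE[OF f] assms(3) that by fastforce
    then show ?thesis
      by (simp add: less_mult_imp_div_less)
  qed
  then have "\<pi> ` S \<subseteq> {1..m}"
    by (auto simp: \<pi>_def Suc_le_eq)
  moreover have "card {v \<in> S. \<pi> v = i} \<le> d" for i
  proof -
    \<comment> \<open>The numbers with quotient \<open>i - 1\<close> by \<open>d\<close>. For
      \<open>i = 0\<close> the subtraction truncates, but that fibre is empty, since every colour is
      positive.\<close>
    let ?I = "{(i - 1) * d..<(i - 1) * d + d}"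
    have "inj_on f {v \<in> S. \<pi> v = i}"
      using f by (auto simp: bij_betw_def inj_on_def)
    moreover have "f ` {v \<in> S. \<pi> v = i} \<subseteq> ?I"
      using assms(2) dividend_less_div_times[of d] by (auto simp: \<pi>_def add.commute)
    ultimately have "card {v \<in> S. \<pi> v = i} \<le> card ?I"
      by (intro card_inj_on_le) auto
    then show ?thesis by simp
  qed
  ultimately show ?thesis by blast
qed

lemma free_chromatic_number_le:
  fixes G :: "'a pair_pre_digraph" and H :: "'b pair_pre_digraph"
  assumes "finite (pverts H)" and "2 \<le> card (pverts G)"
    and "card (pverts H) \<le> m * (card (pverts G) - 1)"
  shows "free_chromatic_number G H \<le> m"
proof -
  obtain \<pi> where \<pi>: "\<pi> ` pverts H \<subseteq> {1..m}"
    and fibre: "\<And>i. card {v \<in> pverts H. \<pi> v = i} \<le> card (pverts G) - 1"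
    using ex_bounded_fibres[OF assms(1) _ assms(3)] assms(2) by auto
  \<comment> \<open>A copy of \<open>G\<close> needs at least one vertex more than any fibre has;
    \<open>card (pverts G) - 1\<close> is a true predecessor here.\<close>
  have "\<not> contains_copy G (with_proj H \<restriction> {v \<in> pverts H. \<pi> v = i})" for i
    using contains_copy_card[of G "with_proj H \<restriction> {v \<in> pverts H. \<pi> v = i}"] fibre[of i] assms
    by auto
  then have "free_colouring G m H \<pi>"
    using \<pi> by (simp add: free_colouring_def)
  then show ?thesis
    unfolding free_chromatic_number_def by (blast intro: Least_le)
qed

theorem theorem14:
  fixes G :: "'a pair_pre_digraph" and H :: "'b pair_pre_digraph" and k :: nat
  assumes "pair_graph G" and "2 \<le> card (pverts G)"
    and "pair_graph H"
    and "k \<ge> 1"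
    and "k_free_minimal k G H"
  shows "card (pverts H) \<ge> (k - 1) * (card (pverts G) - 1) + 1"
proof (rule ccontr)
  interpret H: pair_graph H by fact
  assume "\<not> ?thesis"
  \<comment> \<open>The \<open>+ 1\<close> in the bound makes its negation exactly the size
    condition for \<open>m = k - 1\<close>.\<close>
  then have "free_chromatic_number G H \<le> k - 1"
    using H.pair_finite_verts assms(2) by (intro free_chromatic_number_le) auto
  \<comment> \<open>As \<open>k \<ge> 1\<close>, \<open>k - 1\<close> is strictly below
    \<open>k\<close>, the chromatic number.\<close>
  then show False
    using assms(4,5) by (simp add: k_free_minimal_def)
qed

end
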